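(* Let $\kappa=(\{\kappa_n\},\{r_n\})$ be a measure of concordance. Let $\{\gamma_k\}$ be the sequence of constants defined by $$\gamma_1=\frac12,\qquad \gamma_{p+1}=\frac12\left(1-\sum_{k=1}^p\gamma_k\binom{2p+1}{2k-1}\right)\quad\text{for }p\ge1.$$ If $C$ is an $n$-copula, $R\subseteq\overline n=\{1,\dots,n\}$ with $r=\mathrm{card}(R)$, and $n-r\ge2p+1$, then for $p\ge1$ we have $$\mathfrak A_{2p+1}(C_R)=\sum_{j=1}^p\gamma_{p-j+1}\binom{n-r-2j}{2p-2j+1}\,\mathfrak A_{2j}(C_R).$$
   Context: Notation. $I=[0,1]$, $\overline{n}=\{1,\dots,n\}$, and $[0,x]=[0,x_1]\times\cdots\times[0,x_n]$ for $x\in I^n$. For $n\ge 1$ an $n$-copula is a function $C:I^n\to I$ for which there is a (necessarily unique) Borel probability measure $\mu_C$ on $I^n$ whose one-dimensional marginals are all Lebesgue measure on $I$ and which satisfies $\mu_C([0,x])=C(x)$. $M(t_1,\dots,t_n)=\min(t_1,\dots,t_n)$ and $\Pi(t_1,\dots,t_n)=t_1\cdots t_n$. Symmetries. A permutation of $I^n$ is a map $\tau(x_1,\dots,x_n)=(x_{\tau'(1)},\dots,x_{\tau'(n)})$, where $\tau'$ is a permutation of $\overline n$. The elementary reflection $\sigma_i$ of $I^n$ replaces $x_i$ by $1-x_i$ and fixes the other coordinates; $\mathcal{R}_n$ is the group of reflections (compositions of elementary reflections, including the identity), and $\sigma=\sigma_1\cdots\sigma_n$. For a permutation or reflection $\xi$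 of $I^n$ and an $n$-copula $C$, $\xi^*(C)$ is the $n$-copula $[\xi^*(C)](x)=\mu_C(\xi([0,x]))$. For $n$-copulas $A,B$, $A\prec_{\mathcal C}B$ means $A\le B$ and $\sigma^*(A)\le\sigma^*(B)$ pointwise. Marginals. For an $n$-copula $C$ and $T\subseteq\overline n$ with $t=\mathrm{card}(T)$, $C_T:I^n\to I$ is the function obtained from $C$ by setting $x_i=1$ for all $i\in T$. Its proper copula is the $(n-t)$-copula obtained by regarding $C_T$ as a function of the remaining variables $x_i$, $i\notin T$, listed in increasing order of index; $\kappa_{n-t}(C_T)$ means $\kappa_{n-t}$ of this proper copula. A measure of concordance $\kappa=(\{\kappa_n\},\{r_n\})$ consists of maps $\kappa_n$ from the set of $n$-copulas to $\mathbb R$ and real numbers $r_n$, $n\ge2$, such that for all $n\ge2$ and all $n$-copulas $A,B,C,C_m$: A1 $\kappa_n(M)=1$, $\kappa_n(\Pi)=0$; A2 if $A\prec_{\mathcal C}B$ then $\kappa_n(A)\le\kappa_n(B)$; A3 if $C_m\to C$ uniformly then $\kappa_n(C_m)\to\kappa_n(C)$ as $m\to\infty$; A4 $\kappa_n(\tau^*(C))=\kappa_n(C)$ for every permutation $\tau$ of $I^n$; A5 $\kappa_n(\sigma^*(C))=\kappa_n(C)$; A6 $\sum_{\rho\in\mathcal R_n}\kappa_n(\rho^*(C))=0$; A7 $r_n\kappa_n(C)=\kappa_{n+1}(E)+\kappa_{n+1}(\sigma_1^*(E))$ whenever $E$ is an $(n+1)$-copula with $C(x_1,\dots,x_n)=E(1,x_1,\dots,x_n)$.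 Set notation. $Q+R$ denotes $Q\cup R$ with the understanding that $Q\cap R=\emptyset$. $S(k)$ is the set of subsets of $S$ of cardinality $k$. For $R\subseteq\overline n$ with $r=\mathrm{card}(R)$ and $2\le j\le n-r$, $$\mathfrak A_j(C_R)=r_{n-r}r_{n-r-1}\cdots r_j\sum_{Q\in(\overline n\setminus R)(n-j-r)}\kappa_j(C_{Q+R})$$ (the product has the single factor $r_{n-r}$ when $j=n-r$). Here $r$ without a subscript is $\mathrm{card}(R)$, while $r_k$ are the constants of $\kappa$. *)

theory Defs
  imports "HOL-Probability.Probability" "HOL-Combinatorics.Permutations"
begin

text \<open>A point of the \<open>n\<close>-dimensional unit cube is an extensional function on the index set
  \<open>{1..n}\<close>. A real function on the cube is in turn taken extensional, so that two functions that
  agree on the cube are equal.\<close>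

type_synonym vec = "nat \<Rightarrow> real"

definition cube :: "nat \<Rightarrow> vec set" where
  "cube n = {1..n} \<rightarrow>\<^sub>E {0..1}"

definition cube_borel :: "nat \<Rightarrow> vec measure" where
  "cube_borel n = Pi\<^sub>M {1..n} (\<lambda>_. restrict_space borel {0..1})"

definition box_below :: "nat \<Rightarrow> vec \<Rightarrow> vec set" where
  "box_below n x = (\<Pi>\<^sub>E i\<in>{1..n}. {0..x i})"

definition represents :: "nat \<Rightarrow> vec measure \<Rightarrow> (vec \<Rightarrow> real) \<Rightarrow> bool" where
  "represents n \<mu> C \<longleftrightarrow>
     prob_space \<mu> \<and> sets \<mu> = sets (cube_borel n) \<and>
     (\<forall>i\<in>{1..n}. distr \<mu> (restrict_space lborel {0..1}) (\<lambda>x. x i) = restrict_space lborel {0..1}) \<and>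
     (\<forall>x\<in>cube n. measure \<mu> (box_below n x) = C x)"

lemma space_cube_borel: "space (cube_borel n) = cube n"
  by (simp add: cube_borel_def cube_def space_PiM space_restrict_space)

lemma box_below_in_sets: "x \<in> cube n \<Longrightarrow> box_below n x \<in> sets (cube_borel n)"
  unfolding cube_borel_def box_below_def
  by (rule sets_PiM_I_finite) (auto simp: sets_restrict_space_iff cube_def PiE_iff)

lemma box_below_subset: "x \<in> cube n \<Longrightarrow> box_below n x \<subseteq> cube n"
  unfolding box_below_def cube_def
  by (rule PiE_mono) (simp add: PiE_iff)

lemma sets_cube_borel: "sets (cube_borel n) = sigma_sets (cube n) (box_below n ` cube n)"
proof
  have sub: "box_below n ` cube n \<subseteq> Pow (cube n)"
    using box_below_subset by blast
  let ?S = "sigma (cube n) (box_below n ` cube n)"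
  have S: "sets ?S = sigma_sets (cube n) (box_below n ` cube n)" "space ?S = cube n"
    using sub by (auto simp: sets_measure_of space_measure_of)
  have m: "(\<lambda>x. x) \<in> measurable ?S (Pi\<^sub>M {1..n} (\<lambda>_. restrict_space borel {0..1::real}))"
  proof (rule measurable_PiM_single')
    show "(\<lambda>x. x) \<in> space ?S \<rightarrow> (\<Pi>\<^sub>E i\<in>{1..n}. space (restrict_space borel {0..1::real}))"
      using S by (auto simp: cube_def space_restrict_space)
    fix i assume i: "i \<in> {1..n}"
    show "(\<lambda>x. x i) \<in> measurable ?S (restrict_space borel {0..1::real})"
    proof (rule measurable_restrict_space2)
      show "(\<lambda>x. x i) \<in> space ?S \<rightarrow> {0..1}"
        using S i by (auto simp: cube_def PiE_iff)
      show "(\<lambda>x. x i) \<in> borel_measurable ?S"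
        unfolding borel_measurable_iff_le
      proof
        fix a :: real
        consider "a < 0" | "a \<ge> 1" | "0 \<le> a" "a < 1" by linarith
        then show "{w \<in> space ?S. w i \<le> a} \<in> sets ?S"
        proof cases
          case 1
          have "w i \<ge> 0" if "w \<in> cube n" for w
            using that i by (auto simp: cube_def PiE_iff)
          with 1 have "\<not> w i \<le> a" if "w \<in> cube n" for w
            using that by (meson le_less_trans not_le)
          then have "{w \<in> space ?S. w i \<le> a} = {}"
            unfolding S by blast
          then show ?thesis by (metis sets.empty_sets)
        next
          case 2
          have "w i \<le> 1" if "w \<in> cube n" for w
            using that i by (auto simp: cube_def PiE_iff)
          with 2 have "{w \<in> space ?S. w i \<le> a} = space ?S"
            unfolding S by (auto intro: order_trans)
          then show ?thesis by (metis sets.top)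
        next
          case 3
          let ?x = "\<lambda>j\<in>{1..n}. if j = i then a else 1"
          have "?x \<in> cube n" using 3 by (auto simp: cube_def)
          moreover have "{w \<in> space ?S. w i \<le> a} = box_below n ?x"
            unfolding S
          proof (intro equalityI subsetI)
            fix w assume "w \<in> {w \<in> cube n. w i \<le> a}"
            then show "w \<in> box_below n ?x" by (simp add: cube_def PiE_iff box_below_def)
          next
            fix w assume w: "w \<in> box_below n ?x"
            have *: "0 \<le> w j \<and> w j \<le> (if j = i then a else 1)" if j: "j \<in> {1..n}" for j
            proof -
              have "w j \<in> {0..?x j}"
                using w j unfolding box_below_def by (rule PiE_mem)
              with j show ?thesis by simp
            qed
            have "w j \<in> {0..1}" if "j \<in> {1..n}" for j
              using *[OF that] 3 by (simp split: if_splits)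
            moreover have "w \<in> extensional {1..n}" using w by (simp add: box_below_def PiE_iff)
            ultimately show "w \<in> {w \<in> cube n. w i \<le> a}"
              using *[OF i] by (simp add: cube_def PiE_iff)
          qed
          ultimately show ?thesis using S by auto
        qed
      qed
    qed
  qed
  show "sets (cube_borel n) \<subseteq> sigma_sets (cube n) (box_below n ` cube n)"
  proof
    fix A assume A: "A \<in> sets (cube_borel n)"
    have "(\<lambda>x. x) -` A \<inter> space ?S \<in> sets ?S"
      using m A unfolding cube_borel_def by (rule measurable_sets)
    moreover have "A \<subseteq> cube n" using sets.sets_into_space[OF A] space_cube_borel by simp
    ultimately show "A \<in> sigma_sets (cube n) (box_below n ` cube n)"
      using S by (simp add: Int_absorb2)
  qed
  show "sigma_sets (cube n) (box_below n ` cube n) \<subseteq> sets (cube_borel n)"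
    using sets.sigma_sets_subset[of "box_below n ` cube n" "cube_borel n"]
      box_below_in_sets unfolding space_cube_borel by blast
qed

lemma represents_unique:
  assumes "represents n \<mu> C" "represents n \<nu> C"
  shows "\<mu> = \<nu>"
proof -
  interpret mu: prob_space \<mu> using assms(1) by (simp add: represents_def)
  interpret nu: prob_space \<nu> using assms(2) by (simp add: represents_def)
  have one: "box_below n (\<lambda>i\<in>{1..n}. 1) = cube n" "(\<lambda>i\<in>{1..n}. 1) \<in> cube n"
    by (auto simp: box_below_def cube_def intro!: PiE_cong)
  show ?thesis
  proof (rule measure_eqI_generator_eq[where E = "box_below n ` cube n" and \<Omega> = "cube n"
        and A = "\<lambda>_. cube n"])
    show "Int_stable (box_below n ` cube n)"
    proof (rule Int_stableI_image)
      fix x y assume "x \<in> cube n" "y \<in> cube n"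
      then show "\<exists>z\<in>cube n. box_below n x \<inter> box_below n y = box_below n z"
        by (intro bexI[of _ "\<lambda>i\<in>{1..n}. min (x i) (y i)"])
          (auto simp: box_below_def cube_def PiE_iff)
    qed
    show "box_below n ` cube n \<subseteq> Pow (cube n)"
      using box_below_subset by blast
    show "sets \<mu> = sigma_sets (cube n) (box_below n ` cube n)"
      "sets \<nu> = sigma_sets (cube n) (box_below n ` cube n)"
      using assms by (simp_all add: represents_def sets_cube_borel)
    show "range (\<lambda>_. cube n) \<subseteq> box_below n ` cube n" using one by (metis image_eqI image_subsetI)
    show "(\<Union>i::nat. cube n) = cube n" by simp
    show "emeasure \<mu> (cube n) \<noteq> \<infinity>" by simp
    fix X assume "X \<in> box_below n ` cube n"
    then show "emeasure \<mu> X = emeasure \<nu> X"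
      using assms by (auto simp: represents_def mu.emeasure_eq_measure nu.emeasure_eq_measure)
  qed
qed

definition copulas :: "nat \<Rightarrow> (vec \<Rightarrow> real) set" where
  "copulas n = {C. n \<ge> 1 \<and> C \<in> cube n \<rightarrow>\<^sub>E {0..1} \<and> (\<exists>\<mu>. represents n \<mu> C)}"

definition copula_measure :: "nat \<Rightarrow> (vec \<Rightarrow> real) \<Rightarrow> vec measure" where
  "copula_measure n C = (THE \<mu>. represents n \<mu> C)"

lemma represents_copula_measure: "C \<in> copulas n \<Longrightarrow> represents n (copula_measure n C) C"
  unfolding copulas_def copula_measure_def
  by (rule theI') (use represents_unique in blast)

definition copula_M :: "nat \<Rightarrow> vec \<Rightarrow> real" where
  "copula_M n = (\<lambda>t\<in>cube n. Min (t ` {1..n}))"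

definition copula_Pi :: "nat \<Rightarrow> vec \<Rightarrow> real" where
  "copula_Pi n = (\<lambda>t\<in>cube n. \<Prod>i\<in>{1..n}. t i)"

definition permutation_map :: "nat \<Rightarrow> (nat \<Rightarrow> nat) \<Rightarrow> vec \<Rightarrow> vec" where
  "permutation_map n \<pi> x = (\<lambda>i\<in>{1..n}. x (\<pi> i))"

definition elem_reflection :: "nat \<Rightarrow> vec \<Rightarrow> vec" where
  "elem_reflection i x = x(i := 1 - x i)"

text \<open>Reflections are defined on all of \<^typ>\<open>vec\<close>; distinct reflections in
  \<open>reflections n\<close> remain distinct on the cube, so sums over this set are sums over the
  reflection group of the cube.\<close>

inductive_set reflections :: "nat \<Rightarrow> (vec \<Rightarrow> vec) set" for n :: nat where
  id: "id \<in> reflections n"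
| comp: "\<rho> \<in> reflections n \<Longrightarrow> i \<in> {1..n} \<Longrightarrow> elem_reflection i \<circ> \<rho> \<in> reflections n"

primrec full_reflection :: "nat \<Rightarrow> vec \<Rightarrow> vec" where
  "full_reflection 0 = id"
| "full_reflection (Suc n) = full_reflection n \<circ> elem_reflection (Suc n)"

definition pullback :: "nat \<Rightarrow> (vec \<Rightarrow> vec) \<Rightarrow> (vec \<Rightarrow> real) \<Rightarrow> vec \<Rightarrow> real" where
  "pullback n \<xi> C = (\<lambda>x\<in>cube n. measure (copula_measure n C) (\<xi> ` box_below n x))"

definition concordance_le :: "nat \<Rightarrow> (vec \<Rightarrow> real) \<Rightarrow> (vec \<Rightarrow> real) \<Rightarrow> bool" where
  "concordance_le n A B \<longleftrightarrow>
     (\<forall>x\<in>cube n. A x \<le> B x) \<and>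
     (\<forall>x\<in>cube n. pullback n (full_reflection n) A x \<le> pullback n (full_reflection n) B x)"

definition cons_one :: "nat \<Rightarrow> vec \<Rightarrow> vec" where
  "cons_one n x = (\<lambda>i\<in>{1..n+1}. if i = 1 then 1 else x (i - 1))"

locale measure_of_concordance =
  fixes \<kappa> :: "nat \<Rightarrow> (vec \<Rightarrow> real) \<Rightarrow> real" and r :: "nat \<Rightarrow> real"
  assumes normalization_M: "n \<ge> 2 \<Longrightarrow> \<kappa> n (copula_M n) = 1"
    and normalization_Pi: "n \<ge> 2 \<Longrightarrow> \<kappa> n (copula_Pi n) = 0"
    and monotonicity: "\<lbrakk>n \<ge> 2; A \<in> copulas n; B \<in> copulas n; concordance_le n A B\<rbrakk>
          \<Longrightarrow> \<kappa> n A \<le> \<kappa> n B"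
    and continuity: "\<lbrakk>n \<ge> 2; \<And>m. Cs m \<in> copulas n; C \<in> copulas n;
            uniform_limit (cube n) Cs C sequentially\<rbrakk>
          \<Longrightarrow> (\<lambda>m. \<kappa> n (Cs m)) \<longlonglongrightarrow> \<kappa> n C"
    and permutation_invariance: "\<lbrakk>n \<ge> 2; C \<in> copulas n; \<pi> permutes {1..n}\<rbrakk>
          \<Longrightarrow> \<kappa> n (pullback n (permutation_map n \<pi>) C) = \<kappa> n C"
    and duality: "\<lbrakk>n \<ge> 2; C \<in> copulas n\<rbrakk>
          \<Longrightarrow> \<kappa> n (pullback n (full_reflection n) C) = \<kappa> n C"
    and reflection_symmetry: "\<lbrakk>n \<ge> 2; C \<in> copulas n\<rbrakk>
          \<Longrightarrow> (\<Sum>\<rho>\<in>reflections n. \<kappa> n (pullback n \<rho> C)) = 0"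
    and transition: "\<lbrakk>n \<ge> 2; C \<in> copulas n; E \<in> copulas (n + 1);
            \<And>x. x \<in> cube n \<Longrightarrow> C x = E (cons_one n x)\<rbrakk>
          \<Longrightarrow> r n * \<kappa> n C =
              \<kappa> (n + 1) E + \<kappa> (n + 1) (pullback (n + 1) (elem_reflection 1) E)"

definition marginal :: "nat \<Rightarrow> (vec \<Rightarrow> real) \<Rightarrow> nat set \<Rightarrow> vec \<Rightarrow> real" where
  "marginal n C T = (\<lambda>x\<in>cube n. C (\<lambda>i\<in>{1..n}. if i \<in> T then 1 else x i))"

text \<open>The variable \<open>x i\<close> with \<open>i \<notin> T\<close> becomes variable number
  \<open>card {k \<in> {1..n} - T. k \<le> i}\<close> of the proper copula. The value inserted at the
  coordinates in \<open>T\<close> is irrelevant, since \<^term>\<open>marginal n C T\<close> does not depend on them.\<close>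

definition proper_copula :: "nat \<Rightarrow> (vec \<Rightarrow> real) \<Rightarrow> nat set \<Rightarrow> vec \<Rightarrow> real" where
  "proper_copula n C T =
     (\<lambda>y\<in>cube (n - card T). marginal n C T
        (\<lambda>i\<in>{1..n}. if i \<in> T then 1 else y (card {k \<in> {1..n} - T. k \<le> i})))"

definition \<AA> :: "(nat \<Rightarrow> (vec \<Rightarrow> real) \<Rightarrow> real) \<Rightarrow> (nat \<Rightarrow> real) \<Rightarrow> nat \<Rightarrow> (vec \<Rightarrow> real) \<Rightarrow> nat set \<Rightarrow>
    nat \<Rightarrow> real" where
  "\<AA> \<kappa> r n C R j =
     (\<Prod>k\<in>{j..n - card R}. r k) *
     (\<Sum>Q | Q \<subseteq> {1..n} - R \<and> card Q = n - j - card R. \<kappa> j (proper_copula n C (Q \<union> R)))"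

end

theory Submission
  imports Defs
begin

text \<open>By A7, reflecting one coordinate of a copula acts on \<open>\<kappa>\<close> as a multiple of "pass to the marginal"
  minus the identity. Hence reflecting all coordinates yields a signed sum over all marginals; by A5
  it does not change \<open>\<kappa>\<close>. In odd dimension the copula itself occurs in that sum with sign \<open>-1\<close>, so
  \<open>\<kappa>\<close> is expressed by proper marginals. Summing over all marginals of dimension \<open>2p + 1\<close> gives
  \<open>2 \<AA>\<^bsub>2p+1\<^esub> = (\<Sum>j = 2..2p. (-1)\<^sup>j (N-j choose 2p+1-j) \<AA>\<^sub>j)\<close> with \<open>N = n - card R\<close>. Eliminating the
  odd-indexed terms on the right by induction produces the recursion for \<open>\<gamma>\<close>.\<close>

section \<open>Uniform random variables on the unit interval\<close>

text \<open>Lebesgue measure is invariant under affine maps of slope -1, and this one maps the unit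
  interval onto itself.\<close>

lemma lborel_unit_reflection:
  "distr (restrict_space lborel {0..1}) (restrict_space lborel {0..1}) (\<lambda>x::real. 1 - x) =
    restrict_space lborel {0..1}" (is "distr ?L ?L ?f = ?L")
proof (rule measure_eqI)
  have f: "?f \<in> measurable ?L ?L"
    by (rule measurable_restrict_space3) auto
  fix A assume "A \<in> sets (distr ?L ?L ?f)"
  then have A: "A \<in> sets ?L" by simp
  then have A': "A \<in> sets lborel" "A \<subseteq> {0..1}" by (auto simp: sets_restrict_space_iff)
  have sp: "space ?L = {0..1}" by (simp add: space_restrict_space)
  have eq: "?f -` A \<inter> {0..1} = ?f -` A"
    using A'(2) by auto
  have "emeasure (distr ?L ?L ?f) A = emeasure ?L (?f -` A)"
    using f A by (simp add: emeasure_distr sp eq)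
  also have "\<dots> = emeasure lborel (?f -` A)"
    using eq by (subst emeasure_restrict_space) auto
  also have "\<dots> = emeasure (distr lborel borel (\<lambda>x. 1 + (-1) * x)) A"
    using A' by (subst emeasure_distr) auto
  also have "\<dots> = emeasure lborel A"
    using A' lborel_real_affine[of "-1" 1] by (simp add: density_1)
  also have "\<dots> = emeasure ?L A"
    using A' by (subst emeasure_restrict_space) auto
  finally show "emeasure (distr ?L ?L ?f) A = emeasure ?L A" .
qed simp

text \<open>\<open>distr\<close> accepts arbitrary functions, hence the separate measurability
  condition. The equation of laws has the shape of the marginal condition in
  \<open>represents\<close>.\<close>

definition uniform_rv :: "'a measure \<Rightarrow> ('a \<Rightarrow> real) \<Rightarrow> bool" where
  "uniform_rv M X \<longleftrightarrow> X \<in> measurable M (restrict_space borel {0..1}) \<and>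
     distr M (restrict_space lborel {0..1}) X = restrict_space lborel {0..1}"

lemma uniform_rv_range: "uniform_rv M X \<Longrightarrow> \<omega> \<in> space M \<Longrightarrow> 0 \<le> X \<omega> \<and> X \<omega> \<le> 1"
  using measurable_space[of X M "restrict_space borel {0..1}" \<omega>]
  by (simp add: uniform_rv_def space_restrict_space)

lemma uniform_rv_reflect:
  assumes "uniform_rv M X"
  shows "uniform_rv M (\<lambda>\<omega>. 1 - X \<omega>)"
proof -
  let ?B = "restrict_space borel {0..1::real}" and ?L = "restrict_space lborel {0..1::real}"
  have X: "X \<in> measurable M ?B" and D: "distr M ?L X = ?L"
    using assms by (auto simp: uniform_rv_def)
  have f: "(\<lambda>x. 1 - x) \<in> measurable ?B ?B" "(\<lambda>x. 1 - x) \<in> measurable ?L ?L"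
    by (rule measurable_restrict_space3; auto)+
  have BL: "measurable M ?B = measurable M ?L"
    by (rule measurable_cong_sets) (simp_all add: sets_restrict_space)
  have "distr M ?L (\<lambda>\<omega>. 1 - X \<omega>) = distr (distr M ?L X) ?L (\<lambda>x. 1 - x)"
    using X f BL by (subst distr_distr) (auto simp: comp_def)
  also have "\<dots> = ?L"
    by (simp add: D lborel_unit_reflection)
  finally show ?thesis
    using measurable_compose[OF X f(1)] by (simp add: uniform_rv_def)
qed

section \<open>Copulas of random vectors\<close>

text \<open>This is the distribution function of the random vector \<open>(U 1, ..., U m)\<close>.
  With \<open>M\<close> fixed, reflections, permutations and marginals become mere changes of the
  family \<open>U\<close>.\<close>

definition joint_copula :: "'a measure \<Rightarrow> nat \<Rightarrow> (nat \<Rightarrow> 'a \<Rightarrow> real) \<Rightarrow> vec \<Rightarrow> real" where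
  "joint_copula M m U = (\<lambda>x\<in>cube m. measure M {\<omega> \<in> space M. \<forall>i\<in>{1..m}. U i \<omega> \<le> x i})"

lemma joint_copula_cong:
  assumes "\<And>i \<omega>. i \<in> {1..m} \<Longrightarrow> \<omega> \<in> space M \<Longrightarrow> U i \<omega> = V i \<omega>"
  shows "joint_copula M m U = joint_copula M m V"
  unfolding joint_copula_def
  by (intro restrict_ext arg_cong[of _ _ "measure M"]) (use assms in auto)

definition joint_rv :: "nat \<Rightarrow> (nat \<Rightarrow> 'a \<Rightarrow> real) \<Rightarrow> 'a \<Rightarrow> vec" where
  "joint_rv m U \<omega> = (\<lambda>i\<in>{1..m}. U i \<omega>)"

definition reflect :: "nat set \<Rightarrow> vec \<Rightarrow> vec" where
  "reflect S x = (\<lambda>i. if i \<in> S then 1 - x i else x i)"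

context prob_space
begin

lemma joint_rv_measurable:
  assumes "\<And>i. i \<in> {1..m} \<Longrightarrow> uniform_rv M (U i)"
  shows "joint_rv m U \<in> measurable M (cube_borel m)"
  unfolding joint_rv_def cube_borel_def
  by (rule measurable_restrict) (use assms in \<open>auto simp: uniform_rv_def\<close>)

text \<open>The representing measure is the law of the random vector; its coordinates are uniform by
  hypothesis.\<close>

lemma represents_joint_copula:
  assumes U: "\<And>i. i \<in> {1..m} \<Longrightarrow> uniform_rv M (U i)"
  shows "represents m (distr M (cube_borel m) (joint_rv m U)) (joint_copula M m U)"
  unfolding represents_def
proof (intro conjI ballI)
  note J = joint_rv_measurable[of m U, OF U]
  show "prob_space (distr M (cube_borel m) (joint_rv m U))"
    by (rule prob_space_distr[OF J])
  show "sets (distr M (cube_borel m) (joint_rv m U)) = sets (cube_borel m)"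
    by simp
next
  note J = joint_rv_measurable[of m U, OF U]
  fix i assume i: "i \<in> {1..m}"
  have "(\<lambda>x. x i) \<in> measurable (cube_borel m) (restrict_space borel {0..1})"
    unfolding cube_borel_def using i by (rule measurable_component_singleton)
  then have c: "(\<lambda>x. x i) \<in> measurable (cube_borel m) (restrict_space lborel {0..1})"
    by (subst measurable_cong_sets[OF refl, of _ "restrict_space borel {0..1}"])
      (simp_all add: sets_restrict_space)
  have "distr (distr M (cube_borel m) (joint_rv m U)) (restrict_space lborel {0..1}) (\<lambda>x. x i)
      = distr M (restrict_space lborel {0..1}) (U i)"
    using i by (subst distr_distr[OF c J])
      (auto intro!: arg_cong[of _ _ "distr M _"] simp: comp_def joint_rv_def)
  then show "distr (distr M (cube_borel m) (joint_rv m U)) (restrict_space lborel {0..1})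
      (\<lambda>x. x i) = restrict_space lborel {0..1}"
    using U[OF i] by (simp add: uniform_rv_def)
next
  note J = joint_rv_measurable[of m U, OF U]
  fix x assume x: "x \<in> cube m"
  \<comment> \<open>The lower bounds of the box hold because uniform variables are
    nonnegative.\<close>
  have "joint_rv m U -` box_below m x \<inter> space M = {\<omega> \<in> space M. \<forall>i\<in>{1..m}. U i \<omega> \<le> x i}"
    using uniform_rv_range[OF U] by (auto simp: joint_rv_def box_below_def PiE_iff)
  then show "measure (distr M (cube_borel m) (joint_rv m U)) (box_below m x) = joint_copula M m U x"
    using x by (simp only: measure_distr[OF J box_below_in_sets[OF x]] joint_copula_def restrict_apply'[OF x])
qed

lemma joint_copula_in_copulas:
  assumes "m \<ge> 1" "\<And>i. i \<in> {1..m} \<Longrightarrow> uniform_rv M (U i)"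
  shows "joint_copula M m U \<in> copulas m"
  using represents_joint_copula[of m U] assms by (auto simp: copulas_def joint_copula_def)

text \<open>By uniqueness of representing measures, \<open>copula_measure\<close> is the law of the
  vector. The map \<open>\<eta>\<close> plays the inverse of \<open>\<xi>\<close> on the cube: the
  vector lies in the image of a box under \<open>\<xi>\<close> iff its image under
  \<open>\<eta>\<close> lies in the box.\<close>

lemma pullback_joint_copula:
  assumes m: "m \<ge> 1" and U: "\<And>i. i \<in> {1..m} \<Longrightarrow> uniform_rv M (U i)"
    and meas: "\<And>x. x \<in> cube m \<Longrightarrow> \<xi> ` box_below m x \<in> sets (cube_borel m)"
    and iff: "\<And>x y. x \<in> cube m \<Longrightarrow> y \<in> cube m \<Longrightarrow> y \<in> \<xi> ` box_below m x \<longleftrightarrow> \<eta> y \<in> box_below m x"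
    and W: "\<And>\<omega> i. \<omega> \<in> space M \<Longrightarrow> i \<in> {1..m} \<Longrightarrow> \<eta> (joint_rv m U \<omega>) i = W i \<omega>"
    and ext: "\<And>y. y \<in> cube m \<Longrightarrow> \<eta> y \<in> cube m"
  shows "pullback m \<xi> (joint_copula M m U) = joint_copula M m W"
proof -
  note J = joint_rv_measurable[of m U, OF U]
  have cm: "copula_measure m (joint_copula M m U) = distr M (cube_borel m) (joint_rv m U)"
    using represents_unique[OF represents_copula_measure[OF joint_copula_in_copulas[OF m U]]
        represents_joint_copula[OF U]] .
  have cube: "joint_rv m U \<omega> \<in> cube m" if "\<omega> \<in> space M" for \<omega>
    using measurable_space[OF J that] by (simp add: space_cube_borel)
  have "joint_rv m U -` (\<xi> ` box_below m x) \<inter> space M =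
      {\<omega> \<in> space M. \<forall>i\<in>{1..m}. W i \<omega> \<le> x i}" if x: "x \<in> cube m" for x
  proof -
    have "joint_rv m U \<omega> \<in> \<xi> ` box_below m x \<longleftrightarrow> (\<forall>i\<in>{1..m}. W i \<omega> \<le> x i)"
      if \<omega>: "\<omega> \<in> space M" for \<omega>
    proof -
      have "\<eta> (joint_rv m U \<omega>) \<in> cube m" using ext cube \<omega> by blast
      then have "\<eta> (joint_rv m U \<omega>) \<in> box_below m x \<longleftrightarrow> (\<forall>i\<in>{1..m}. W i \<omega> \<le> x i)"
        using W[OF \<omega>] by (auto simp: cube_def box_below_def PiE_iff)
      then show ?thesis using iff[OF x cube[OF \<omega>]] by simp
    qed
    then show ?thesis by auto
  qed
  then have "measure (distr M (cube_borel m) (joint_rv m U)) (\<xi> ` box_below m x) =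
      prob {\<omega> \<in> space M. \<forall>i\<in>{1..m}. W i \<omega> \<le> x i}" if "x \<in> cube m" for x
    using that by (simp only: measure_distr[OF J meas])
  then show ?thesis
    unfolding pullback_def joint_copula_def[of M m W] cm by (rule restrict_ext)
qed

text \<open>A reflection is its own inverse, so it serves as both \<open>\<xi>\<close> and
  \<open>\<eta>\<close> in \<open>pullback_joint_copula\<close>.\<close>

lemma pullback_reflect_joint_copula:
  assumes m: "m \<ge> 1" and U: "\<And>i. i \<in> {1..m} \<Longrightarrow> uniform_rv M (U i)" and S: "S \<subseteq> {1..m}"
  shows "pullback m (reflect S) (joint_copula M m U) =
    joint_copula M m (\<lambda>i \<omega>. if i \<in> S then 1 - U i \<omega> else U i \<omega>)"
proof (rule pullback_joint_copula[where \<eta> = "reflect S"])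
  have cube: "reflect S y \<in> cube m" if "y \<in> cube m" for y
    using that S by (auto simp: cube_def reflect_def PiE_iff extensional_def)
  have inv: "reflect S (reflect S y) = y" for y
    by (auto simp: reflect_def)
  have iff: "y \<in> reflect S ` box_below m x \<longleftrightarrow> reflect S y \<in> box_below m x" for x y
    using inv by (metis image_iff)
  show "y \<in> reflect S ` box_below m x \<longleftrightarrow> reflect S y \<in> box_below m x" for x y
    by (rule iff)
  show "reflect S y \<in> cube m" if "y \<in> cube m" for y
    using cube that .
  fix x assume x: "x \<in> cube m"
  \<comment> \<open>The image of a box is again a product of intervals, which gives its
    measurability.\<close>
  have "reflect S ` box_below m x = (\<Pi>\<^sub>E i\<in>{1..m}. if i \<in> S then {1 - x i..1} else {0..x i})"
    (is "_ = ?P")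
  proof (intro set_eqI)
    fix y
    have "reflect S y \<in> box_below m x \<longleftrightarrow> y \<in> ?P"
      using S by (auto simp: box_below_def reflect_def PiE_iff extensional_def split: if_splits)
    then show "y \<in> reflect S ` box_below m x \<longleftrightarrow> y \<in> ?P" by (simp only: iff)
  qed
  also have "\<dots> \<in> sets (cube_borel m)"
    unfolding cube_borel_def
    by (rule sets_PiM_I_finite)
      (use x in \<open>auto simp: sets_restrict_space_iff cube_def PiE_iff\<close>)
  finally show "reflect S ` box_below m x \<in> sets (cube_borel m)" .
qed (use m U S in \<open>auto simp: reflect_def joint_rv_def\<close>)

text \<open>\<open>pullback\<close> measures forward images, so the inverse map acts on the
  variables; pulling back along \<open>inv \<pi>\<close> therefore lists them as
  \<open>U (\<pi> i)\<close>.\<close>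

lemma pullback_permutation_joint_copula:
  assumes m: "m \<ge> 1" and U: "\<And>i. i \<in> {1..m} \<Longrightarrow> uniform_rv M (U i)"
    and \<pi>: "\<pi> permutes {1..m}"
  shows "pullback m (permutation_map m (inv \<pi>)) (joint_copula M m U) =
    joint_copula M m (\<lambda>i. U (\<pi> i))"
proof (rule pullback_joint_copula[where \<eta> = "permutation_map m \<pi>"])
  have \<pi>': "inv \<pi> permutes {1..m}" by (rule permutes_inv[OF \<pi>])
  have into: "\<rho> i \<in> {1..m}" if "\<rho> permutes {1..m}" "i \<in> {1..m}" for \<rho> i
    using permutes_in_image[OF that(1)] that(2) by blast
  have cube: "permutation_map m \<rho> y \<in> cube m" if "\<rho> permutes {1..m}" "y \<in> cube m" for \<rho> y
    using that(2) into[OF that(1)] by (auto simp: cube_def permutation_map_def PiE_iff)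
  have inv1: "permutation_map m (inv \<pi>) (permutation_map m \<pi> y) = y"
    if "y \<in> extensional {1..m}" for y
    using that into[OF \<pi>'] permutes_inverses[OF \<pi>]
    by (intro extensionalityI[of _ "{1..m}"]) (auto simp: permutation_map_def)
  have inv2: "permutation_map m \<pi> (permutation_map m (inv \<pi>) y) = y"
    if "y \<in> extensional {1..m}" for y
    using that into[OF \<pi>] permutes_inverses[OF \<pi>]
    by (intro extensionalityI[of _ "{1..m}"]) (auto simp: permutation_map_def)
  have ext: "y \<in> extensional {1..m}" if "y \<in> cube m \<or> (\<exists>x. y \<in> box_below m x)" for y
    using that by (auto simp: cube_def box_below_def PiE_iff)
  show iff: "y \<in> permutation_map m (inv \<pi>) ` box_below m x \<longleftrightarrow>
      permutation_map m \<pi> y \<in> box_below m x" if "x \<in> cube m" "y \<in> cube m" for x y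
    using inv1 inv2 ext that by (metis (mono_tags, lifting) image_iff)
  show "permutation_map m \<pi> y \<in> cube m" if "y \<in> cube m" for y
    using cube[OF \<pi> that] .
  fix x assume x: "x \<in> cube m"
  have "permutation_map m (inv \<pi>) ` box_below m x = box_below m (permutation_map m (inv \<pi>) x)"
  proof (intro equalityI subsetI)
    fix y assume "y \<in> permutation_map m (inv \<pi>) ` box_below m x"
    then show "y \<in> box_below m (permutation_map m (inv \<pi>) x)"
      using into[OF \<pi>'] by (auto simp: box_below_def permutation_map_def PiE_iff)
  next
    fix y assume y: "y \<in> box_below m (permutation_map m (inv \<pi>) x)"
    then have "y \<in> cube m"
      using box_below_subset[OF cube[OF \<pi>' x]] by blast
    moreover have "y (\<pi> i) \<in> {0..x i}" if "i \<in> {1..m}" for i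
      using y into[OF \<pi> that] permutes_inverses(2)[OF \<pi>, of i]
      unfolding box_below_def permutation_map_def PiE_iff by (metis (no_types, lifting) restrict_apply')
    then have "permutation_map m \<pi> y \<in> box_below m x"
      by (auto simp: box_below_def permutation_map_def)
    ultimately show "y \<in> permutation_map m (inv \<pi>) ` box_below m x"
      using iff[OF x] by blast
  qed
  then show "permutation_map m (inv \<pi>) ` box_below m x \<in> sets (cube_borel m)"
    using box_below_in_sets[OF cube[OF \<pi>' x]] by simp
next
  fix \<omega> i assume "i \<in> {1..m}"
  then show "permutation_map m \<pi> (joint_rv m U \<omega>) i = U (\<pi> i) \<omega>"
    using permutes_in_image[OF \<pi>, of i] by (simp add: permutation_map_def joint_rv_def)
qed (use m U in auto)

end

section \<open>The reflection group as a power set\<close>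

lemma elem_reflection_eq_reflect: "elem_reflection i = reflect {i}"
  by (auto simp: fun_eq_iff elem_reflection_def reflect_def)

lemma full_reflection_eq_reflect: "full_reflection n = reflect {1..n}"
proof (induction n)
  case 0
  show ?case by (auto simp: reflect_def)
next
  case (Suc n)
  show ?case
    unfolding full_reflection.simps Suc by (auto simp: fun_eq_iff reflect_def elem_reflection_def)
qed

text \<open>The image of the zero vector has ones exactly at the reflected coordinates. Injectivity
  permits reindexing the sum in A6 by subsets.\<close>

lemma inj_reflect: "inj reflect"
proof (rule injI)
  fix S T assume "reflect S = reflect T"
  then have "reflect S (\<lambda>_. 0) i = reflect T (\<lambda>_. 0) i" for i by simp
  then have "i \<in> S \<longleftrightarrow> i \<in> T" for i
    unfolding reflect_def by (metis diff_zero zero_neq_one)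
  then show "S = T" by blast
qed

text \<open>Composing with \<open>elem_reflection i\<close> toggles membership of \<open>i\<close>
  in the set of reflected coordinates; conversely, a finite set is built up one element at a
  time.\<close>

lemma reflections_eq: "reflections n = reflect ` Pow {1..n}"
proof (intro equalityI subsetI)
  fix \<rho> assume "\<rho> \<in> reflections n"
  then show "\<rho> \<in> reflect ` Pow {1..n}"
  proof induction
    case id
    have "id = reflect {}" by (auto simp: reflect_def)
    then show ?case by blast
  next
    case (comp \<rho> i)
    then obtain S where S: "S \<subseteq> {1..n}" "\<rho> = reflect S" by blast
    have "elem_reflection i \<circ> \<rho> = reflect (if i \<in> S then S - {i} else insert i S)"
      unfolding S(2) by (auto simp: fun_eq_iff elem_reflection_def reflect_def)
    then show ?case using S comp by auto
  qed
next
  fix \<rho> assume "\<rho> \<in> reflect ` Pow {1..n}"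
  then obtain S where S: "S \<subseteq> {1..n}" "\<rho> = reflect S" by blast
  have "finite S" using S(1) finite_subset by blast
  then have "reflect S \<in> reflections n" using S(1)
  proof (induction S)
    case empty
    have "reflect {} = id" by (auto simp: reflect_def)
    then show ?case using reflections.id by metis
  next
    case (insert i S)
    have "reflect (insert i S) = elem_reflection i \<circ> reflect S"
      using insert.hyps by (auto simp: fun_eq_iff elem_reflection_def reflect_def)
    then show ?case using reflections.comp[of "reflect S" n i] insert by (simp only: insert_subset)
  qed
  then show "\<rho> \<in> reflections n" using S by simp
qed


section \<open>Marginals as copulas of subfamilies\<close>

text \<open>The rank is strictly increasing on \<open>A\<close>, hence injective, and counting its
  values gives surjectivity. This is the numbering of variables in
  \<open>proper_copula\<close>.\<close>

lemma bij_betw_rank: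
  fixes A :: "nat set"
  assumes "finite A"
  shows "bij_betw (\<lambda>i. card {k \<in> A. k \<le> i}) A {1..card A}"
proof -
  let ?f = "\<lambda>i. card {k \<in> A. k \<le> i}"
  have less: "?f i < ?f j" if "i \<in> A" "j \<in> A" "i < j" for i j
  proof (rule psubset_card_mono)
    have "j \<in> {k \<in> A. k \<le> j}" "j \<notin> {k \<in> A. k \<le> i}" using that by auto
    moreover have "{k \<in> A. k \<le> i} \<subseteq> {k \<in> A. k \<le> j}" using that by auto
    ultimately show "{k \<in> A. k \<le> i} \<subset> {k \<in> A. k \<le> j}" by blast
  qed (use assms in auto)
  have inj: "inj_on ?f A"
  proof (rule inj_onI)
    fix i j assume "i \<in> A" "j \<in> A" "?f i = ?f j"
    then show "i = j" using less[of i j] less[of j i] by (cases i j rule: linorder_cases) auto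
  qed
  have "?f i \<in> {1..card A}" if "i \<in> A" for i
  proof -
    have "card {i} \<le> ?f i" by (rule card_mono) (use assms that in auto)
    moreover have "?f i \<le> card A" by (rule card_mono) (use assms in auto)
    ultimately show ?thesis by simp
  qed
  then have "?f ` A = {1..card A}"
    by (intro card_subset_eq) (auto simp: card_image[OF inj])
  with inj show ?thesis by (simp add: bij_betw_def)
qed

text \<open>A coordinate set to 1 puts no constraint on a variable with values in the unit interval,
  so the remaining variables determine the marginal. The map \<open>g\<close> inverts the
  rank.\<close>

lemma (in prob_space) proper_copula_joint_copula:
  assumes T: "T \<subseteq> {1..n}" and U: "\<And>i. i \<in> {1..n} \<Longrightarrow> uniform_rv M (U i)"
  obtains g where "bij_betw g {1..n - card T} ({1..n} - T)"
    "proper_copula n (joint_copula M n U) T = joint_copula M (n - card T) (\<lambda>i. U (g i))"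
proof -
  define A where "A = {1..n} - T"
  define m where "m = n - card T"
  define rk where "rk i = card {k \<in> A. k \<le> i}" for i
  define g where "g = inv_into A rk"
  have m: "card A = m"
    using T by (simp add: A_def m_def card_Diff_subset finite_subset[OF T])
  have rk: "bij_betw rk A {1..m}"
    using bij_betw_rank[of A] by (simp add: A_def rk_def[abs_def] m[symmetric])
  have g: "bij_betw g {1..m} A"
    unfolding g_def by (rule bij_betw_inv_into[OF rk])
  have rk_into: "rk i \<in> {1..m}" if "i \<in> A" for i
    using rk that by (meson bij_betwE)
  have "proper_copula n (joint_copula M n U) T = joint_copula M m (\<lambda>i. U (g i))"
    unfolding proper_copula_def joint_copula_def[of M m] m_def[symmetric] A_def[symmetric]
      rk_def[symmetric]
  proof (rule restrict_ext)
    fix y assume y: "y \<in> cube m"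
    define v where "v = (\<lambda>i\<in>{1..n}. if i \<in> T then 1 else y (rk i))"
    have v: "v \<in> cube n"
      using y rk_into by (auto simp: cube_def v_def PiE_iff A_def)
    have "(\<lambda>i\<in>{1..n}. if i \<in> T then 1 else v i) = v"
      by (auto simp: v_def fun_eq_iff)
    then have "marginal n (joint_copula M n U) T v = joint_copula M n U v"
      using v by (simp add: marginal_def)
    also have "\<dots> = prob {\<omega> \<in> space M. \<forall>i\<in>{1..n}. U i \<omega> \<le> v i}"
      using v by (simp add: joint_copula_def)
    also have "{\<omega> \<in> space M. \<forall>i\<in>{1..n}. U i \<omega> \<le> v i} =
        {\<omega> \<in> space M. \<forall>l\<in>{1..m}. U (g l) \<omega> \<le> y l}"
    proof (intro Collect_cong conj_cong refl)
      fix \<omega> assume \<omega>: "\<omega> \<in> space M"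
      have "(\<forall>i\<in>{1..n}. U i \<omega> \<le> v i) \<longleftrightarrow> (\<forall>i\<in>A. U i \<omega> \<le> y (rk i))"
        using uniform_rv_range[OF U \<omega>] by (auto simp: v_def A_def)
      also have "\<dots> \<longleftrightarrow> (\<forall>l\<in>{1..m}. U (g l) \<omega> \<le> y (rk (g l)))"
        using bij_betw_imp_surj_on[OF g] by blast
      also have "\<dots> \<longleftrightarrow> (\<forall>l\<in>{1..m}. U (g l) \<omega> \<le> y l)"
        using bij_betw_inv_into_right[OF rk] by (simp add: g_def)
      finally show "(\<forall>i\<in>{1..n}. U i \<omega> \<le> v i) \<longleftrightarrow> (\<forall>l\<in>{1..m}. U (g l) \<omega> \<le> y l)" .
    qed
    finally show "marginal n (joint_copula M n U) T v = prob {\<omega> \<in> space M. \<forall>l\<in>{1..m}. U (g l) \<omega> \<le> y l}" .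
  qed
  with g show thesis
    using that unfolding m_def A_def by blast
qed

text \<open>Such a set is determined by its part outside \<open>B\<close>, an arbitrary subset of
  \<open>P - B\<close> with \<open>m - card B\<close> elements.\<close>

lemma card_intermediate_sets:
  assumes "finite P" "B \<subseteq> P" "card B \<le> m"
  shows "card {A. B \<subseteq> A \<and> A \<subseteq> P \<and> card A = m} = (card P - card B) choose (m - card B)"
proof -
  have fB: "finite B" using assms finite_subset by blast
  have "bij_betw (\<lambda>A. A - B) {A. B \<subseteq> A \<and> A \<subseteq> P \<and> card A = m} {D. D \<subseteq> P - B \<and> card D = m - card B}"
  proof (rule bij_betw_byWitness[where f' = "\<lambda>D. D \<union> B"])
    show "(\<lambda>D. D \<union> B) ` {D. D \<subseteq> P - B \<and> card D = m - card B}
        \<subseteq> {A. B \<subseteq> A \<and> A \<subseteq> P \<and> card A = m}"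
    proof safe
      fix D assume D: "D \<subseteq> P - B" "card D = m - card B"
      then have "finite D" using assms(1) by (meson finite_Diff finite_subset)
      then show "card (D \<union> B) = m"
        using D fB assms(3) by (subst card_Un_disjoint) auto
    qed (use assms in auto)
  qed (auto simp: card_Diff_subset fB)
  then have "card {A. B \<subseteq> A \<and> A \<subseteq> P \<and> card A = m} = card {D. D \<subseteq> P - B \<and> card D = m - card B}"
    by (rule bij_betw_same_card)
  also have "\<dots> = (card P - card B) choose (m - card B)"
    using assms fB by (simp add: n_subsets card_Diff_subset)
  finally show ?thesis .
qed

section \<open>Concordance as a function of sets of variables\<close>

text \<open>All marginals and reflections of one copula are handled on a single probability space,
  through subfamilies of \<open>V\<close>.\<close>

locale concordance_of_uniforms = measure_of_concordance \<kappa> r + prob_space M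
  for \<kappa> r and M :: "'a measure" +
  fixes V :: "nat \<Rightarrow> 'a \<Rightarrow> real" and I :: "nat set"
  assumes finite_I: "finite I" and uniform: "i \<in> I \<Longrightarrow> uniform_rv M (V i)"
begin

definition reflected_rv :: "nat set \<Rightarrow> nat \<Rightarrow> 'a \<Rightarrow> real" where
  "reflected_rv S i \<omega> = (if i \<in> S then 1 - V i \<omega> else V i \<omega>)"

definition enumeration :: "nat set \<Rightarrow> nat \<Rightarrow> nat" where
  "enumeration A = (SOME g. bij_betw g {1..card A} A)"

text \<open>By A4 the order in which the members of \<open>A\<close> are listed is irrelevant (\<open>K_eq\<close>), so that \<open>K A S\<close>
  stands for the concordance of \<open>(V i)\<^bsub>i \<in> A\<^esub>\<close> with the coordinates in \<open>S\<close> reflected. Passing to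
  a marginal then just removes an element from \<open>A\<close>, without renumbering.\<close>

definition K :: "nat set \<Rightarrow> nat set \<Rightarrow> real" where
  "K A S = \<kappa> (card A) (joint_copula M (card A) (\<lambda>i. reflected_rv S (enumeration A i)))"

lemma uniform_reflected_rv: "i \<in> I \<Longrightarrow> uniform_rv M (reflected_rv S i)"
  using uniform[of i] uniform_rv_reflect[of M "V i"] by (cases "i \<in> S") (simp_all add: reflected_rv_def[abs_def])

lemma bij_betw_enumeration: "finite A \<Longrightarrow> bij_betw (enumeration A) {1..card A} A"
  unfolding enumeration_def by (erule someI_ex[OF ex_bij_betw_nat_finite_1])

lemma finite_sub: "A \<subseteq> I \<Longrightarrow> finite A"
  using finite_I finite_subset by blast

lemma uniform_enumeration:
  assumes "A \<subseteq> I" "bij_betw g {1..m} A" "i \<in> {1..m}"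
  shows "uniform_rv M (reflected_rv S (g i))"
  using assms uniform_reflected_rv by (meson bij_betwE subsetD)

lemma K_eq:
  assumes A: "A \<subseteq> I" and g: "bij_betw g {1..m} A" and m: "m \<ge> 2"
  shows "\<kappa> m (joint_copula M m (\<lambda>i. reflected_rv S (g i))) = K A S"
proof -
  define h where "h = enumeration A"
  have mA: "card A = m" using bij_betw_same_card[OF g] by simp
  have h: "bij_betw h {1..m} A"
    unfolding h_def using bij_betw_enumeration[OF finite_sub[OF A]] mA by simp
  \<comment> \<open>\<open>\<rho>\<close> is chosen so that \<open>h (\<rho> i) = g i\<close>;
    outside \<open>{1..m}\<close> it is the identity, as \<open>permutes\<close> demands.\<close>
  define \<rho> where "\<rho> i = (if i \<in> {1..m} then inv_into {1..m} h (g i) else i)" for i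
  have "bij_betw (inv_into {1..m} h \<circ> g) {1..m} {1..m}"
    by (rule bij_betw_trans[OF g bij_betw_inv_into[OF h]])
  then have "bij_betw \<rho> {1..m} {1..m}"
    by (rule bij_betw_cong[THEN iffD1, rotated]) (simp add: \<rho>_def)
  then have \<rho>: "\<rho> permutes {1..m}"
    by (rule bij_imp_permutes) (simp only: \<rho>_def if_False)
  have h\<rho>: "h (\<rho> i) = g i" if "i \<in> {1..m}" for i
  proof -
    have "g i \<in> A" using g that by (meson bij_betwE)
    then show ?thesis
      using that bij_betw_inv_into_right[OF h] by (simp add: \<rho>_def)
  qed
  have U: "uniform_rv M (reflected_rv S (h i))" if "i \<in> {1..m}" for i
    by (rule uniform_enumeration[OF A h that])
  have "joint_copula M m (\<lambda>i. reflected_rv S (g i)) = joint_copula M m (\<lambda>i. reflected_rv S (h (\<rho> i)))"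
    by (rule joint_copula_cong) (simp only: h\<rho>)
  also have "\<dots> = pullback m (permutation_map m (inv \<rho>)) (joint_copula M m (\<lambda>i. reflected_rv S (h i)))"
    using m by (intro pullback_permutation_joint_copula[OF _ U \<rho>, symmetric]) auto
  finally have "joint_copula M m (\<lambda>i. reflected_rv S (g i)) =
      pullback m (permutation_map m (inv \<rho>)) (joint_copula M m (\<lambda>i. reflected_rv S (h i)))" .
  moreover have "\<kappa> m (pullback m (permutation_map m (inv \<rho>)) (joint_copula M m (\<lambda>i. reflected_rv S (h i)))) =
      \<kappa> m (joint_copula M m (\<lambda>i. reflected_rv S (h i)))"
    using m by (intro permutation_invariance joint_copula_in_copulas U permutes_inv[OF \<rho>]) auto
  ultimately show ?thesis by (simp add: K_def mA h_def)
qed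

lemma K_cong:
  assumes A: "A \<subseteq> I" and ST: "S \<inter> A = T \<inter> A"
  shows "K A S = K A T"
proof -
  have "reflected_rv S (enumeration A i) = reflected_rv T (enumeration A i)" if "i \<in> {1..card A}" for i
  proof -
    have "enumeration A i \<in> A" using bij_betw_enumeration[OF finite_sub[OF A]] that by (meson bij_betwE)
    then have "enumeration A i \<in> S \<longleftrightarrow> enumeration A i \<in> T" using ST by blast
    then show ?thesis by (simp add: reflected_rv_def[abs_def])
  qed
  then have "joint_copula M (card A) (\<lambda>i. reflected_rv S (enumeration A i)) =
      joint_copula M (card A) (\<lambda>i. reflected_rv T (enumeration A i))"
    by (intro joint_copula_cong) simp
  then show ?thesis by (simp add: K_def)
qed

text \<open>Reflecting a coordinate twice restores it, so reflections combine by symmetric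
  difference: the last hypothesis says that on \<open>A\<close> the set \<open>T'\<close> is the
  symmetric difference of \<open>T\<close> and the image of \<open>S\<close> under
  \<open>g\<close>.\<close>

lemma K_reflect:
  assumes A: "A \<subseteq> I" and g: "bij_betw g {1..m} A" and m: "m \<ge> 2" and S: "S \<subseteq> {1..m}"
    and T: "\<And>i. i \<in> {1..m} \<Longrightarrow> g i \<in> T' \<longleftrightarrow> (i \<in> S \<longleftrightarrow> g i \<notin> T)"
  shows "\<kappa> m (pullback m (reflect S) (joint_copula M m (\<lambda>i. reflected_rv T (g i)))) = K A T'"
proof -
  have "pullback m (reflect S) (joint_copula M m (\<lambda>i. reflected_rv T (g i))) =
      joint_copula M m (\<lambda>i \<omega>. if i \<in> S then 1 - reflected_rv T (g i) \<omega> else reflected_rv T (g i) \<omega>)"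
    using m by (intro pullback_reflect_joint_copula[OF _ uniform_enumeration[OF A g] S]) auto
  also have "\<dots> = joint_copula M m (\<lambda>i. reflected_rv T' (g i))"
    by (rule joint_copula_cong) (use T in \<open>auto simp: reflected_rv_def\<close>)
  finally show ?thesis using K_eq[OF A g m] by simp
qed

text \<open>Reflecting all coordinates complements the set of reflected indices in \<open>A\<close>;
  A5 applies.\<close>

lemma K_duality:
  assumes A: "A \<subseteq> I" and m: "card A \<ge> 2"
  shows "K A (A - S) = K A S"
proof -
  let ?m = "card A"
  note g = bij_betw_enumeration[OF finite_sub[OF A]]
  have "K A (A - S) =
      \<kappa> ?m (pullback ?m (reflect {1..?m}) (joint_copula M ?m (\<lambda>i. reflected_rv S (enumeration A i))))"
    using bij_betwE[OF g] by (intro K_reflect[OF A g m, symmetric]) auto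
  also have "\<dots> = \<kappa> ?m (joint_copula M ?m (\<lambda>i. reflected_rv S (enumeration A i)))"
    unfolding full_reflection_eq_reflect[symmetric]
    using m by (intro duality joint_copula_in_copulas uniform_enumeration[OF A g]) auto
  finally show ?thesis by (simp add: K_def)
qed

text \<open>This is A6, with the subsets of \<open>{1..card A}\<close> transported to
  \<open>A\<close> by the enumeration.\<close>

lemma K_sum_reflections:
  assumes A: "A \<subseteq> I" and m: "card A \<ge> 2"
  shows "(\<Sum>S\<in>Pow A. K A S) = 0"
proof -
  let ?m = "card A" and ?g = "enumeration A"
  note g = bij_betw_enumeration[OF finite_sub[OF A]]
  let ?C = "joint_copula M ?m (\<lambda>i. reflected_rv {} (?g i))"
  have "0 = (\<Sum>\<rho>\<in>reflections ?m. \<kappa> ?m (pullback ?m \<rho> ?C))"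
    using m by (intro reflection_symmetry[symmetric] joint_copula_in_copulas uniform_enumeration[OF A g]) auto
  also have "\<dots> = (\<Sum>S\<in>Pow {1..?m}. \<kappa> ?m (pullback ?m (reflect S) ?C))"
    unfolding reflections_eq by (subst sum.reindex) (auto intro: inj_on_subset[OF inj_reflect])
  also have "\<dots> = (\<Sum>S\<in>Pow {1..?m}. K A (?g ` S))"
  proof (intro sum.cong refl)
    fix S assume S: "S \<in> Pow {1..?m}"
    show "\<kappa> ?m (pullback ?m (reflect S) ?C) = K A (?g ` S)"
    proof (rule K_reflect[OF A g m])
      fix i assume "i \<in> {1..?m}"
      then show "?g i \<in> ?g ` S \<longleftrightarrow> (i \<in> S \<longleftrightarrow> ?g i \<notin> {})"
        using inj_on_image_mem_iff[OF bij_betw_imp_inj_on[OF g]] S by auto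
    qed (use S in auto)
  qed
  also have "\<dots> = (\<Sum>S\<in>Pow A. K A S)"
    by (rule sum.reindex_bij_betw[OF bij_betw_Pow[OF g]])
  finally show ?thesis by simp
qed

section \<open>Reflection of a single coordinate\<close>

text \<open>Setting the coordinate of \<open>i\<close> to 1 removes \<open>i\<close> from
  \<open>A\<close>, and reflecting it adds \<open>i\<close> to \<open>S\<close>, so this is A7.
  Three indices leave a marginal of dimension at least 2.\<close>

lemma K_transition:
  assumes A: "A \<subseteq> I" and i: "i \<in> A" "i \<notin> S" and m: "card A \<ge> 3"
  shows "r (card A - 1) * K (A - {i}) S = K A S + K A (insert i S)"
proof -
  define m where "m = card A - 1"
  have fA: "finite A" by (rule finite_sub[OF A])
  have cA: "card A = m + 1" and m2: "m \<ge> 2" using m by (auto simp: m_def)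
  have cAi: "card (A - {i}) = m" using i fA by (simp add: m_def)
  define h where "h = enumeration (A - {i})"
  have h: "bij_betw h {1..m} (A - {i})"
    unfolding h_def using bij_betw_enumeration[of "A - {i}"] fA cAi by simp
  \<comment> \<open>A7 acts on the first coordinate, so \<open>i\<close> is listed first, followed
    by an enumeration of the rest.\<close>
  define g where "g k = (if k = 1 then i else h (k - 1))" for k
  have img: "g ` {1..m + 1} = A"
  proof -
    have "{1..m + 1} = insert 1 (Suc ` {1..m})"
      by auto
    then have "g ` {1..m + 1} = insert (g 1) ((\<lambda>k. g (Suc k)) ` {1..m})"
      by (simp only: image_insert image_image)
    also have "\<dots> = insert i (h ` {1..m})"
      by (auto simp: g_def)
    also have "\<dots> = A" using bij_betw_imp_surj_on[OF h] i by auto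
    finally show ?thesis .
  qed
  have g: "bij_betw g {1..m + 1} A"
    unfolding bij_betw_def using img cA
    by (intro conjI eq_card_imp_inj_on)
      (simp_all only: finite_atLeastAtMost card_atLeastAtMost diff_Suc_1 Suc_eq_plus1)
  have Ai: "A - {i} \<subseteq> I" using A by blast
  note Uh = uniform_enumeration[OF Ai h] and Ug = uniform_enumeration[OF A g]
  let ?C = "joint_copula M m (\<lambda>k. reflected_rv S (h k))" and ?E = "joint_copula M (m + 1) (\<lambda>k. reflected_rv S (g k))"
  have "?C x = ?E (cons_one m x)" if x: "x \<in> cube m" for x
  proof -
    have c: "cons_one m x \<in> cube (m + 1)"
    proof -
      have "x (k - 1) \<in> {0..1}" if "k \<in> {1..m + 1}" "k \<noteq> 1" for k
        using x that by (intro PiE_mem[of x "{1..m}"]) (auto simp: cube_def)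
      then show ?thesis by (auto simp: cube_def cons_one_def)
    qed
    have "(\<forall>k\<in>{1..m}. reflected_rv S (h k) \<omega> \<le> x k) \<longleftrightarrow> (\<forall>k\<in>{1..m + 1}. reflected_rv S (g k) \<omega> \<le> cons_one m x k)"
      if \<omega>: "\<omega> \<in> space M" for \<omega>
    proof
      assume *: "\<forall>k\<in>{1..m}. reflected_rv S (h k) \<omega> \<le> x k"
      show "\<forall>k\<in>{1..m + 1}. reflected_rv S (g k) \<omega> \<le> cons_one m x k"
      proof
        fix k assume k: "k \<in> {1..m + 1}"
        show "reflected_rv S (g k) \<omega> \<le> cons_one m x k"
        \<comment> \<open>At \<open>k = 1\<close> the bound is 1, which every uniform variable
          respects.\<close>
        proof (cases "k = 1")
          case True
          then show ?thesis using uniform_rv_range[OF Ug[OF k] \<omega>] k by (simp add: cons_one_def)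
        next
          case False
          then have "k - 1 \<in> {1..m}" using k by auto
          then show ?thesis using * False k by (simp add: cons_one_def g_def)
        qed
      qed
    next
      assume *: "\<forall>k\<in>{1..m + 1}. reflected_rv S (g k) \<omega> \<le> cons_one m x k"
      show "\<forall>k\<in>{1..m}. reflected_rv S (h k) \<omega> \<le> x k"
      proof
        fix k assume "k \<in> {1..m}"
        then show "reflected_rv S (h k) \<omega> \<le> x k"
          using bspec[OF *, of "Suc k"] by (simp add: cons_one_def g_def)
      qed
    qed
    then have "{\<omega> \<in> space M. \<forall>k\<in>{1..m}. reflected_rv S (h k) \<omega> \<le> x k} =
        {\<omega> \<in> space M. \<forall>k\<in>{1..m + 1}. reflected_rv S (g k) \<omega> \<le> cons_one m x k}"
      by blast
    then show ?thesis
      using x c by (simp only: joint_copula_def restrict_apply')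
  qed
  moreover have "?C \<in> copulas m" "?E \<in> copulas (m + 1)"
    using m2 Uh Ug by (auto intro!: joint_copula_in_copulas)
  ultimately have "r m * \<kappa> m ?C =
      \<kappa> (m + 1) ?E + \<kappa> (m + 1) (pullback (m + 1) (elem_reflection 1) ?E)"
    using m2 by (intro transition) auto
  also have "\<kappa> (m + 1) (pullback (m + 1) (elem_reflection 1) ?E) = K A (insert i S)"
    unfolding elem_reflection_eq_reflect
  proof (rule K_reflect[OF A g])
    fix k assume k: "k \<in> {1..m + 1}"
    show "g k \<in> insert i S \<longleftrightarrow> (k \<in> {1} \<longleftrightarrow> g k \<notin> S)"
    proof (cases "k = 1")
      case True
      then show ?thesis using i by (simp add: g_def)
    next
      case False
      then have "k - 1 \<in> {1..m}" using k by auto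
      then have "h (k - 1) \<in> A - {i}" using h by (meson bij_betwE)
      then show ?thesis using False by (simp add: g_def)
    qed
  qed (use m2 in auto)
  finally show ?thesis
    using K_eq[OF Ai h m2] K_eq[OF A g] m2 by (simp add: cA)
qed

text \<open>In dimension two A6 has four terms, which A5 identifies in pairs; half of the sum gives
  the claim.\<close>

lemma K_pair:
  assumes A: "A \<subseteq> I" and i: "i \<in> A" "i \<notin> S" and m: "card A = 2"
  shows "K A S + K A (insert i S) = 0"
proof -
  obtain j where j: "A = {i, j}" "i \<noteq> j"
    using m i by (auto simp: card_2_iff)
  have "Pow A = {{}, {i}, {j}, {i, j}}"
    using j by auto
  then have "K A {} + K A {i} + K A {j} + K A {i, j} = 0"
    using K_sum_reflections[OF A] m j(2) by (simp add: doubleton_eq_iff)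
  moreover have "K A {i, j} = K A {}" "K A {j} = K A {i}"
    using K_duality[OF A, of "{}"] K_duality[OF A, of "{i}"] m j by (simp_all add: insert_Diff_if)
  ultimately have *: "K A {} + K A {i} = 0" "K A {j} + K A {i, j} = 0"
    by linarith+
  show ?thesis
  proof (cases "j \<in> S")
    case True
    have "K A S = K A {j}" "K A (insert i S) = K A {i, j}"
      by (intro K_cong[OF A]; use i j True in auto)+
    then show ?thesis using * by simp
  next
    case False
    have "K A S = K A {}" "K A (insert i S) = K A {i}"
      by (intro K_cong[OF A]; use i j False in auto)+
    then show ?thesis using * by simp
  qed
qed

text \<open>The value \<open>0\<close> below index \<open>2\<close> makes \<open>K_insert\<close> hold for pairs as well, where the reflection
  axiom A6 takes the place of the transition axiom A7.\<close>

definition r_trunc :: "nat \<Rightarrow> real" where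
  "r_trunc k = (if k \<ge> 2 then r k else 0)"

lemma K_insert:
  assumes "A \<subseteq> I" "i \<in> A" "i \<notin> S" "card A \<ge> 2"
  shows "K A (insert i S) = r_trunc (card A - 1) * K (A - {i}) S - K A S"
proof (cases "card A = 2")
  case True
  then show ?thesis using K_pair[OF assms(1-3)] by (simp add: r_trunc_def)
next
  case False
  then have "card A \<ge> 3" "card A - 1 \<ge> 2" using assms by auto
  then show ?thesis using K_transition[OF assms(1-3)] by (simp add: r_trunc_def)
qed

section \<open>Signed expansion over marginals\<close>

text \<open>Iterating \<open>K_insert\<close>, each reflected index is either dropped, with a factor
  \<open>r_trunc\<close>, or kept, with a minus sign. \<open>T\<close> collects the dropped indices,
  so the sign has the parity of \<open>card S - card T\<close>.\<close>

lemma K_expansion: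
  assumes "S \<subseteq> A" "A \<subseteq> I" "card A \<ge> 2"
  shows "K A S = (\<Sum>T\<in>Pow S. (-1) ^ (card S + card T) *
    (\<Prod>k\<in>{card A - card T..<card A}. r_trunc k) * K (A - T) {})"
proof -
  have "finite S" using assms finite_sub by (meson order_trans)
  then show ?thesis using assms
  proof (induction S arbitrary: A)
    case empty
    then show ?case by simp
  next
    case (insert i S)
    let ?f = "\<lambda>A S T. (-1) ^ (card S + card T) *
      (\<Prod>k\<in>{card A - card T..<card A}. r_trunc k) * K (A - T) {}"
    have fA: "finite A" using finite_sub insert by blast
    have i: "i \<in> A" using insert by blast
    have cAi: "card (A - {i}) = card A - 1" using i fA by simp
    have 1: "K A S = sum (?f A S) (Pow S)"
      using insert by (intro insert.IH) auto
    have 2: "r_trunc (card A - 1) * K (A - {i}) S = r_trunc (card A - 1) * sum (?f (A - {i}) S) (Pow S)"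
    \<comment> \<open>The induction hypothesis does not cover the one-element set
      \<open>A - {i}\<close>; there the factor \<open>r_trunc 1 = 0\<close> settles the
      claim.\<close>
    proof (cases "card A = 2")
      case True
      then show ?thesis by (simp add: r_trunc_def)
    next
      case False
      then have "K (A - {i}) S = sum (?f (A - {i}) S) (Pow S)"
        using insert cAi by (intro insert.IH) auto
      then show ?thesis by simp
    qed
    have 3: "r_trunc (card A - 1) * ?f (A - {i}) S T = ?f A (insert i S) (insert i T)"
      if T: "T \<in> Pow S" for T
    proof -
      have fT: "finite T" using T insert.hyps by (meson Pow_iff finite_subset)
      have iT: "i \<notin> T" using T insert.hyps by blast
      have TA: "insert i T \<subseteq> A" using T insert.prems by blast
      have "card (insert i T) \<le> card A" by (rule card_mono[OF fA TA])
      then have cT: "card T + 1 \<le> card A" using fT iT by simp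
      have "{card A - (card T + 1)..<card A} = insert (card A - 1) {card A - 1 - card T..<card A - 1}"
        using cT by auto
      then have "(\<Prod>k\<in>{card A - (card T + 1)..<card A}. r_trunc k) =
          r_trunc (card A - 1) * (\<Prod>k\<in>{card A - 1 - card T..<card A - 1}. r_trunc k)"
        by simp
      moreover have "A - {i} - T = A - insert i T" by blast
      ultimately show ?thesis
        using fT iT insert.hyps cAi by simp
    qed
    have inj: "inj_on (insert i) (Pow S)"
      using insert.hyps by (auto intro!: inj_onI)
    \<comment> \<open>The subsets of \<open>insert i S\<close> are split according to whether
      \<open>i\<close> is kept or dropped.\<close>
    have "(\<Sum>T\<in>Pow (insert i S). ?f A (insert i S) T) =
        (\<Sum>T\<in>Pow S. ?f A (insert i S) T) + (\<Sum>T\<in>Pow S. ?f A (insert i S) (insert i T))"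
      unfolding Pow_insert using insert.hyps
      by (subst sum.union_disjoint) (auto simp: sum.reindex[OF inj])
    also have "(\<Sum>T\<in>Pow S. ?f A (insert i S) (insert i T)) = r_trunc (card A - 1) * K (A - {i}) S"
      unfolding 2 sum_distrib_left using 3 by (intro sum.cong refl) simp
    also have "(\<Sum>T\<in>Pow S. ?f A (insert i S) T) = - K A S"
      unfolding 1 sum_negf[symmetric] using insert.hyps by (intro sum.cong refl) simp
    finally show ?case
      using K_insert[OF insert.prems(2) i insert.hyps(2) insert.prems(3)] by simp
  qed
qed

text \<open>Apply the expansion to \<open>S = A\<close>, where duality turns the left side into
  \<open>K A {}\<close>. Complementation replaces the dropped set \<open>T\<close> by the surviving
  set \<open>B\<close>. As \<open>card A\<close> is odd, the term \<open>B = A\<close> is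
  \<open>- K A {}\<close> and moves to the left.\<close>

lemma K_odd:
  assumes A: "A \<subseteq> I" and odd: "odd (card A)" and m: "card A \<ge> 2"
  shows "2 * K A {} = (\<Sum>B\<in>Pow A - {A}. (-1) ^ card B * (\<Prod>k\<in>{card B..<card A}. r_trunc k) * K B {})"
proof -
  have fA: "finite A" by (rule finite_sub[OF A])
  let ?f = "\<lambda>B. (-1) ^ card B * (\<Prod>k\<in>{card B..<card A}. r_trunc k) * K B {}"
  have "K A {} = K A A" using K_duality[OF A m, of "{}"] by simp
  also have "\<dots> = (\<Sum>T\<in>Pow A. (-1) ^ (card A + card T) *
    (\<Prod>k\<in>{card A - card T..<card A}. r_trunc k) * K (A - T) {})"
    by (rule K_expansion) (use A m in auto)
  also have "\<dots> = sum ?f (Pow A)"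
  proof (rule sum.reindex_bij_witness[where i = "\<lambda>B. A - B" and j = "\<lambda>T. A - T"])
    fix T assume T: "T \<in> Pow A"
    have c: "card (A - T) = card A - card T" "card T \<le> card A"
      using T fA by (auto simp: card_Diff_subset finite_subset card_mono)
    then have "card A + card T = card (A - T) + 2 * card T" by simp
    then have "(-1 :: real) ^ (card A + card T) = (-1) ^ card (A - T)"
      by (simp only: power_add power_mult) simp
    then show "?f (A - T) = (-1) ^ (card A + card T) *
      (\<Prod>k\<in>{card A - card T..<card A}. r_trunc k) * K (A - T) {}"
      using c by simp
  qed auto
  also have "\<dots> = ?f A + sum ?f (Pow A - {A})"
    by (rule sum.remove) (use fA in auto)
  finally show ?thesis using odd by simp
qed

section \<open>Sums over all marginals of a given dimension\<close>

text \<open>This is the sum in \<open>\<AA>\<close> without the constants \<open>r k\<close>,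
  indexed by the remaining coordinates instead of those set to 1.\<close>

definition level :: "nat set \<Rightarrow> nat \<Rightarrow> real" where
  "level P j = (\<Sum>B | B \<subseteq> P \<and> card B = j. K B {})"

text \<open>Sum \<open>K_odd\<close> over all \<open>m\<close>-element subsets of \<open>P\<close>
  and exchange the sums: a set \<open>B\<close> with \<open>j\<close> elements lies in
  \<open>(card P - j) choose (m - j)\<close> of them.\<close>

lemma level_odd:
  assumes P: "P \<subseteq> I" and odd: "odd m" and m: "m \<ge> 2"
  shows "2 * level P m = (\<Sum>j<m. (-1) ^ j * real ((card P - j) choose (m - j)) *
    (\<Prod>k\<in>{j..<m}. r_trunc k) * level P j)"
proof -
  have fP: "finite P" by (rule finite_sub[OF P])
  let ?A = "{A. A \<subseteq> P \<and> card A = m}" and ?B = "{B. B \<subseteq> P \<and> card B < m}"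
  let ?f = "\<lambda>B. (-1) ^ card B * (\<Prod>k\<in>{card B..<m}. r_trunc k) * K B {}"
  have fin: "finite ?A" "finite ?B" using fP by auto
  have "2 * level P m = (\<Sum>A\<in>?A. 2 * K A {})"
    by (simp add: level_def sum_distrib_left)
  also have "\<dots> = (\<Sum>A\<in>?A. \<Sum>B\<in>{B. B \<in> ?B \<and> B \<subseteq> A}. ?f B)"
  proof (intro sum.cong refl)
    fix A assume A: "A \<in> ?A"
    then have fA: "finite A" using fP finite_subset by blast
    have "Pow A - {A} = {B. B \<in> ?B \<and> B \<subseteq> A}"
      using A psubset_card_mono[OF fA] by (auto simp: psubset_eq)
    then show "2 * K A {} = (\<Sum>B\<in>{B. B \<in> ?B \<and> B \<subseteq> A}. ?f B)"
      using K_odd[of A] A P odd m by auto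
  qed
  also have "\<dots> = (\<Sum>B\<in>?B. \<Sum>A\<in>{A. A \<in> ?A \<and> B \<subseteq> A}. ?f B)"
    by (rule sum.swap_restrict[OF fin])
  also have "\<dots> = (\<Sum>B\<in>?B. real ((card P - card B) choose (m - card B)) * ?f B)"
  proof (intro sum.cong refl)
    fix B assume B: "B \<in> ?B"
    have "{A. A \<in> ?A \<and> B \<subseteq> A} = {A. B \<subseteq> A \<and> A \<subseteq> P \<and> card A = m}" by blast
    then show "(\<Sum>A\<in>{A. A \<in> ?A \<and> B \<subseteq> A}. ?f B) =
        real ((card P - card B) choose (m - card B)) * ?f B"
      using B card_intermediate_sets[OF fP, of B m] by simp
  qed
  also have "\<dots> = (\<Sum>j<m. \<Sum>B\<in>{B. B \<in> ?B \<and> card B = j}.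
      real ((card P - card B) choose (m - card B)) * ?f B)"
    by (rule sum.group[symmetric]) (use fin in auto)
  also have "\<dots> = (\<Sum>j<m. (-1) ^ j * real ((card P - j) choose (m - j)) *
    (\<Prod>k\<in>{j..<m}. r_trunc k) * level P j)"
  proof (intro sum.cong refl)
    fix j assume "j \<in> {..<m}"
    then have "{B. B \<in> ?B \<and> card B = j} = {B. B \<subseteq> P \<and> card B = j}" by auto
    then show "(\<Sum>B\<in>{B. B \<in> ?B \<and> card B = j}.
        real ((card P - card B) choose (m - card B)) * ?f B) =
      (-1) ^ j * real ((card P - j) choose (m - j)) * (\<Prod>k\<in>{j..<m}. r_trunc k) * level P j"
      by (simp add: level_def sum_distrib_left mult_ac)
  qed
  finally show ?thesis .
qed

text \<open>Multiplying by the constants \<open>r k\<close> for \<open>k\<close> from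
  \<open>m\<close> to \<open>card P\<close> completes each product over \<open>{j..<m}\<close> to
  the constant in \<open>\<AA>\<close>.\<close>

lemma scaled_level_odd:
  assumes P: "P \<subseteq> I" and odd: "odd m" and m: "m \<ge> 2" "m \<le> card P"
  shows "2 * ((\<Prod>k\<in>{m..card P}. r k) * level P m) =
    (\<Sum>j\<in>{2..<m}. (-1) ^ j * real ((card P - j) choose (m - j)) *
      ((\<Prod>k\<in>{j..card P}. r k) * level P j))"
proof -
  let ?R = "\<Prod>k\<in>{m..card P}. r k"
  let ?f = "\<lambda>j. (-1) ^ j * real ((card P - j) choose (m - j)) *
    (\<Prod>k\<in>{j..<m}. r_trunc k) * level P j"
  have "2 * (?R * level P m) = ?R * (\<Sum>j<m. ?f j)"
    using level_odd[OF P odd m(1)] by simp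
  also have "(\<Sum>j<m. ?f j) = (\<Sum>j\<in>{2..<m}. ?f j)"
  proof (rule sum.mono_neutral_right)
    \<comment> \<open>For \<open>j < 2\<close> the product contains \<open>r_trunc j = 0\<close>, so
      dimensions 0 and 1, which the axioms do not govern, drop out.\<close>
    show "\<forall>j\<in>{..<m} - {2..<m}. ?f j = 0"
    proof
      fix j assume "j \<in> {..<m} - {2..<m}"
      then have "j \<in> {j..<m}" "r_trunc j = 0" by (auto simp: r_trunc_def)
      then have "(\<Prod>k\<in>{j..<m}. r_trunc k) = 0" by (intro prod_zero) auto
      then show "?f j = 0" by simp
    qed
  qed auto
  also have "?R * (\<Sum>j\<in>{2..<m}. ?f j) =
    (\<Sum>j\<in>{2..<m}. (-1) ^ j * real ((card P - j) choose (m - j)) *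
      ((\<Prod>k\<in>{j..card P}. r k) * level P j))"
    unfolding sum_distrib_left
  proof (intro sum.cong refl)
    fix j assume j: "j \<in> {2..<m}"
    have "{j..card P} = {j..<m} \<union> {m..card P}" using j m by auto
    then have "(\<Prod>k\<in>{j..card P}. r k) = (\<Prod>k\<in>{j..<m}. r k) * ?R"
      by (simp add: prod.union_disjoint ivl_disj_int)
    also have "(\<Prod>k\<in>{j..<m}. r k) = (\<Prod>k\<in>{j..<m}. r_trunc k)"
      using j by (intro prod.cong) (auto simp: r_trunc_def)
    finally show "?R * ?f j = (-1) ^ j * real ((card P - j) choose (m - j)) *
      ((\<Prod>k\<in>{j..card P}. r k) * level P j)"
      by (simp add: mult_ac)
  qed
  finally show ?thesis .
qed

text \<open>Complementation in \<open>I - R\<close> exchanges the set \<open>Q\<close> of further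
  coordinates set to 1 with the set \<open>B\<close> of remaining ones; \<open>K_eq\<close> absorbs
  the order in which \<open>proper_copula\<close> lists them.\<close>

lemma \<AA>_eq_level:
  assumes I: "I = {1..n}" and R: "R \<subseteq> I" and j: "2 \<le> j" "j \<le> n - card R"
  shows "\<AA> \<kappa> r n (joint_copula M n V) R j =
    (\<Prod>k\<in>{j..card (I - R)}. r k) * level (I - R) j"
proof -
  have fR: "finite R" using R finite_sub by blast
  have N: "card (I - R) = n - card R" using R fR by (simp add: card_Diff_subset I)
  have "(\<Sum>Q | Q \<subseteq> I - R \<and> card Q = n - j - card R. \<kappa> j (proper_copula n (joint_copula M n V) (Q \<union> R)))
      = level (I - R) j"
    unfolding level_def
  proof (rule sum.reindex_bij_witness[where i = "\<lambda>B. I - R - B" and j = "\<lambda>Q. I - R - Q"])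
    fix Q assume Q: "Q \<in> {Q. Q \<subseteq> I - R \<and> card Q = n - j - card R}"
    have fQ: "finite Q" using Q finite_sub[of Q] by blast
    have "card (I - R - Q) = j" using Q N j fQ by (simp add: card_Diff_subset)
    then show "I - R - Q \<in> {B. B \<subseteq> I - R \<and> card B = j}" by blast
    have T: "Q \<union> R \<subseteq> {1..n}" using Q R I by blast
    have "card (Q \<union> R) = n - j" using Q j fQ fR by (subst card_Un_disjoint) auto
    then have nT: "n - card (Q \<union> R) = j" using j by simp
    obtain g where g: "bij_betw g {1..j} ({1..n} - (Q \<union> R))"
      "proper_copula n (joint_copula M n V) (Q \<union> R) = joint_copula M j (\<lambda>i. V (g i))"
      using proper_copula_joint_copula[OF T, of V] uniform I unfolding nT by blast
    have B: "{1..n} - (Q \<union> R) = I - R - Q" using I by blast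
    have "proper_copula n (joint_copula M n V) (Q \<union> R) = joint_copula M j (\<lambda>i. reflected_rv {} (g i))"
      using g(2) by (simp add: reflected_rv_def[abs_def])
    moreover have "I - R - Q \<subseteq> I" by blast
    ultimately show "K (I - R - Q) {} = \<kappa> j (proper_copula n (joint_copula M n V) (Q \<union> R))"
      using K_eq[of "I - R - Q" g j "{}"] g(1) j(1) unfolding B by simp
  next
    fix B assume B: "B \<in> {B. B \<subseteq> I - R \<and> card B = j}"
    have "finite B" using B finite_sub[of B] by blast
    then show "I - R - B \<in> {Q. Q \<subseteq> I - R \<and> card Q = n - j - card R}"
      using B N by (auto simp: card_Diff_subset)
  qed auto
  then show ?thesis unfolding \<AA>_def N I[symmetric] by simp
qed

end

section \<open>Elimination of the odd-indexed terms\<close>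

lemma sum_even_odd_split:
  fixes f :: "nat \<Rightarrow> real"
  assumes "p \<ge> 1"
  shows "(\<Sum>j\<in>{2..<2 * p + 1}. f j) = (\<Sum>j=1..p. f (2 * j)) + (\<Sum>q\<in>{1..<p}. f (2 * q + 1))"
  using assms
proof (induction p rule: dec_induct)
  case base
  show ?case by (simp add: numeral_2_eq_2)
next
  case (step p)
  have "{2..<2 * Suc p + 1} = insert (2 * p + 2) (insert (2 * p + 1) {2..<2 * p + 1})"
    using step by auto
  then show ?case using step by (simp add: atLeastLessThanSuc)
qed

text \<open>By strong induction the smaller odd terms are replaced by even ones. In the resulting
  coefficient of \<open>a (2 * j)\<close>, \<open>N\<close> enters only through one common binomial
  factor, and the recursion for \<open>\<gamma>\<close> evaluates the rest.\<close>

lemma odd_terms_from_even_terms: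
  fixes a \<gamma> :: "nat \<Rightarrow> real"
  assumes \<gamma>1: "\<gamma> 1 = 1 / 2"
    and \<gamma>: "\<And>q. q \<ge> 1 \<Longrightarrow>
      \<gamma> (q + 1) = 1 / 2 * (1 - (\<Sum>k=1..q. \<gamma> k * real ((2 * q + 1) choose (2 * k - 1))))"
    and a: "\<And>q. q \<ge> 1 \<Longrightarrow> 2 * q + 1 \<le> N \<Longrightarrow>
      2 * a (2 * q + 1) = (\<Sum>j\<in>{2..<2 * q + 1}. (-1) ^ j * real ((N - j) choose (2 * q + 1 - j)) * a j)"
    and p: "p \<ge> 1" "2 * p + 1 \<le> N"
  shows "a (2 * p + 1) =
    (\<Sum>j=1..p. \<gamma> (p - j + 1) * real ((N - 2 * j) choose (2 * p - 2 * j + 1)) * a (2 * j))"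
  using p
proof (induction p rule: less_induct)
  case (less p)
  let ?b = "\<lambda>j. real ((N - 2 * j) choose (2 * p - 2 * j + 1))"
  let ?c = "\<lambda>j q. real ((2 * (p - j) + 1) choose (2 * (q - j) + 1))"
  have "2 * a (2 * p + 1) =
      (\<Sum>j=1..p. (-1) ^ (2 * j) * real ((N - 2 * j) choose (2 * p + 1 - 2 * j)) * a (2 * j)) +
      (\<Sum>q\<in>{1..<p}. (-1) ^ (2 * q + 1) *
        real ((N - (2 * q + 1)) choose (2 * p + 1 - (2 * q + 1))) * a (2 * q + 1))"
    unfolding a[OF less.prems] by (rule sum_even_odd_split[OF less.prems(1)])
  also have "(\<Sum>j=1..p. (-1) ^ (2 * j) * real ((N - 2 * j) choose (2 * p + 1 - 2 * j)) * a (2 * j)) =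
      (\<Sum>j=1..p. ?b j * a (2 * j))"
    by (intro sum.cong refl) (simp add: Suc_diff_le)
  also have "(\<Sum>q\<in>{1..<p}. (-1) ^ (2 * q + 1) *
        real ((N - (2 * q + 1)) choose (2 * p + 1 - (2 * q + 1))) * a (2 * q + 1)) =
      (\<Sum>q\<in>{1..<p}. \<Sum>j\<in>{j. j \<in> {1..p} \<and> j \<le> q}. - (\<gamma> (q - j + 1) * ?c j q * ?b j * a (2 * j)))"
  proof (intro sum.cong refl)
    fix q assume q: "q \<in> {1..<p}"
    let ?d = "real ((N - (2 * q + 1)) choose (2 * p + 1 - (2 * q + 1)))"
    \<comment> \<open>Trinomial revision separates a factor \<open>?c j q\<close> free of
      \<open>N\<close> from a factor \<open>?b j\<close> free of \<open>q\<close>.\<close>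
    have binom: "?d * real ((N - 2 * j) choose (2 * q - 2 * j + 1)) = ?c j q * ?b j"
      if j: "j \<in> {1..q}" for j
    proof -
      have e: "N - 2 * j - (2 * q - 2 * j + 1) = N - (2 * q + 1)"
        "2 * p - 2 * j + 1 - (2 * q - 2 * j + 1) = 2 * p + 1 - (2 * q + 1)"
        "2 * (p - j) + 1 = 2 * p - 2 * j + 1" "2 * (q - j) + 1 = 2 * q - 2 * j + 1"
        using j q by auto
      have "((N - 2 * j) choose (2 * p - 2 * j + 1)) * ((2 * p - 2 * j + 1) choose (2 * q - 2 * j + 1)) =
          ((N - 2 * j) choose (2 * q - 2 * j + 1)) *
          ((N - 2 * j - (2 * q - 2 * j + 1)) choose (2 * p - 2 * j + 1 - (2 * q - 2 * j + 1)))"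
        using j q less.prems by (intro choose_mult) auto
      from this[unfolded e(1,2)] show ?thesis
        unfolding e(3,4) of_nat_mult[symmetric] by (simp only: mult.commute)
    qed
    have "(-1) ^ (2 * q + 1) * ?d * a (2 * q + 1) =
        - (?d * (\<Sum>j=1..q. \<gamma> (q - j + 1) * real ((N - 2 * j) choose (2 * q - 2 * j + 1)) * a (2 * j)))"
      using less.IH[of q] q less.prems by simp
    also have "\<dots> = (\<Sum>j=1..q. - (\<gamma> (q - j + 1) * (?d * real ((N - 2 * j) choose (2 * q - 2 * j + 1))) * a (2 * j)))"
      by (simp add: sum_distrib_left sum_negf mult_ac)
    also have "\<dots> = (\<Sum>j=1..q. - (\<gamma> (q - j + 1) * ?c j q * ?b j * a (2 * j)))"
      by (intro sum.cong refl) (simp only: binom mult.assoc)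
    also have "{1..q} = {j. j \<in> {1..p} \<and> j \<le> q}" using q by auto
    finally show "(-1) ^ (2 * q + 1) * ?d * a (2 * q + 1) =
      (\<Sum>j\<in>{j. j \<in> {1..p} \<and> j \<le> q}. - (\<gamma> (q - j + 1) * ?c j q * ?b j * a (2 * j)))" .
  qed
  also have "\<dots> = (\<Sum>j\<in>{1..p}. \<Sum>q\<in>{q. q \<in> {1..<p} \<and> j \<le> q}. - (\<gamma> (q - j + 1) * ?c j q * ?b j * a (2 * j)))"
    by (rule sum.swap_restrict) auto
  also have "(\<Sum>j=1..p. ?b j * a (2 * j)) + \<dots> =
      (\<Sum>j=1..p. 2 * (\<gamma> (p - j + 1) * ?b j * a (2 * j)))"
    unfolding sum.distrib[symmetric]
  proof (intro sum.cong refl)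
    fix j assume j: "j \<in> {1..p}"
    \<comment> \<open>For \<open>j = p\<close> the sum is empty and this is
      \<open>\<gamma> 1 = 1 / 2\<close>; otherwise it is the recursion at
      \<open>p - j\<close>.\<close>
    have rec: "2 * \<gamma> (p - j + 1) = 1 - (\<Sum>k=1..p - j. \<gamma> k * real ((2 * (p - j) + 1) choose (2 * k - 1)))"
      using \<gamma>[of "p - j"] \<gamma>1 by (cases "p - j = 0") auto
    \<comment> \<open>With \<open>k = q - j + 1\<close> the lower index
      \<open>2 * (q - j) + 1\<close> becomes \<open>2 * k - 1\<close>, and \<open>q < p\<close>
      becomes \<open>k \<le> p - j\<close>.\<close>
    have "(\<Sum>q\<in>{q. q \<in> {1..<p} \<and> j \<le> q}. \<gamma> (q - j + 1) * ?c j q) =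
        (\<Sum>k=1..p - j. \<gamma> k * real ((2 * (p - j) + 1) choose (2 * k - 1)))"
      by (rule sum.reindex_bij_witness[where i = "\<lambda>k. k + j - 1" and j = "\<lambda>q. q - j + 1"])
        (use j in auto)
    then have "(\<Sum>q\<in>{q. q \<in> {1..<p} \<and> j \<le> q}. \<gamma> (q - j + 1) * ?c j q) = 1 - 2 * \<gamma> (p - j + 1)"
      using rec by simp
    then have "(\<Sum>q\<in>{q. q \<in> {1..<p} \<and> j \<le> q}. - (\<gamma> (q - j + 1) * ?c j q * ?b j * a (2 * j))) =
        - ((1 - 2 * \<gamma> (p - j + 1)) * ?b j * a (2 * j))"
      unfolding sum_negf sum_distrib_right[symmetric] by simp
    then show "?b j * a (2 * j) +
        (\<Sum>q\<in>{q. q \<in> {1..<p} \<and> j \<le> q}. - (\<gamma> (q - j + 1) * ?c j q * ?b j * a (2 * j))) =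
        2 * (\<gamma> (p - j + 1) * ?b j * a (2 * j))"
      by (simp add: algebra_simps)
  qed
  finally show ?case by (simp add: sum_distrib_left[symmetric])
qed

section \<open>Coordinate maps under the copula measure, and conclusion\<close>

lemma uniform_rv_coordinate:
  assumes "represents n \<mu> C" "i \<in> {1..n}"
  shows "uniform_rv \<mu> (\<lambda>x. x i)"
proof -
  have s: "sets \<mu> = sets (cube_borel n)" using assms by (simp add: represents_def)
  have "(\<lambda>x. x i) \<in> measurable (cube_borel n) (restrict_space borel {0..1})"
    unfolding cube_borel_def using assms(2) by (rule measurable_component_singleton)
  then show ?thesis
    using assms by (simp add: uniform_rv_def represents_def measurable_cong_sets[OF s refl])
qed

text \<open>For the coordinate maps the event in \<open>joint_copula\<close> is the box itself.
  Every copula is thereby the copula of a random vector, so the results for families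
  \<open>V\<close> apply to it.\<close>

lemma copula_eq_joint_copula:
  assumes C: "C \<in> copulas n"
  shows "C = joint_copula (copula_measure n C) n (\<lambda>i x. x i)"
proof -
  let ?\<mu> = "copula_measure n C"
  have rep: "represents n ?\<mu> C" by (rule represents_copula_measure[OF C])
  then have sp: "space ?\<mu> = cube n"
    using sets_eq_imp_space_eq[of ?\<mu> "cube_borel n"] by (simp add: represents_def space_cube_borel)
  have "{\<omega> \<in> space ?\<mu>. \<forall>i\<in>{1..n}. \<omega> i \<le> x i} = box_below n x" if "x \<in> cube n" for x
  proof (intro equalityI subsetI)
    fix \<omega> assume "\<omega> \<in> box_below n x"
    then show "\<omega> \<in> {\<omega> \<in> space ?\<mu>. \<forall>i\<in>{1..n}. \<omega> i \<le> x i}"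
      using subsetD[OF box_below_subset[OF that], of \<omega>] unfolding sp by (simp add: box_below_def PiE_iff)
  qed (simp add: sp box_below_def cube_def PiE_iff)
  then have "joint_copula ?\<mu> n (\<lambda>i x. x i) x = C x" if "x \<in> cube n" for x
    using that rep by (simp add: joint_copula_def represents_def)
  moreover have "C \<in> extensional (cube n)"
    using C by (auto simp: copulas_def PiE_def)
  ultimately show ?thesis
    by (intro extensionalityI[of _ "cube n"]) (auto simp: joint_copula_def)
qed

theorem theorem6:
  fixes \<kappa> :: "nat \<Rightarrow> (vec \<Rightarrow> real) \<Rightarrow> real" and r :: "nat \<Rightarrow> real"
    and \<gamma> :: "nat \<Rightarrow> real" and C :: "vec \<Rightarrow> real" and R :: "nat set" and n p :: nat
  assumes "measure_of_concordance \<kappa> r"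
    and "\<gamma> 1 = 1 / 2"
    and "\<And>q. q \<ge> 1 \<Longrightarrow>
      \<gamma> (q + 1) = 1 / 2 * (1 - (\<Sum>k=1..q. \<gamma> k * real ((2 * q + 1) choose (2 * k - 1))))"
    and "C \<in> copulas n"
    and "R \<subseteq> {1..n}"
    and "p \<ge> 1"
    and "n - card R \<ge> 2 * p + 1"
  shows "\<AA> \<kappa> r n C R (2 * p + 1) =
    (\<Sum>j=1..p. \<gamma> (p - j + 1) * real ((n - card R - 2 * j) choose (2 * p - 2 * j + 1)) *
       \<AA> \<kappa> r n C R (2 * j))"
proof -
  let ?\<mu> = "copula_measure n C" and ?V = "\<lambda>i x. x i :: real" and ?N = "n - card R"
  have rep: "represents n ?\<mu> C" by (rule represents_copula_measure[OF assms(4)])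
  interpret prob_space ?\<mu> using rep by (simp add: represents_def)
  interpret measure_of_concordance \<kappa> r by (rule assms(1))
  interpret concordance_of_uniforms \<kappa> r ?\<mu> ?V "{1..n}"
    by unfold_locales (use uniform_rv_coordinate[OF rep] in auto)
  have N: "card ({1..n} - R) = ?N"
    using assms(5) by (simp add: card_Diff_subset finite_subset[OF assms(5)])
  \<comment> \<open>\<open>a\<close> agrees with \<open>\<AA>\<close> for
    \<open>2 \<le> j \<le> ?N\<close>, a range that contains every index in the claim.\<close>
  define a where "a j = (\<Prod>k\<in>{j..?N}. r k) * level ({1..n} - R) j" for j
  have A: "\<AA> \<kappa> r n C R j = a j" if "2 \<le> j" "j \<le> ?N" for j
    using \<AA>_eq_level[OF refl assms(5) that]
    unfolding a_def N copula_eq_joint_copula[OF assms(4), symmetric] .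
  have "2 * a (2 * q + 1) =
      (\<Sum>j\<in>{2..<2 * q + 1}. (-1) ^ j * real ((?N - j) choose (2 * q + 1 - j)) * a j)"
    if "q \<ge> 1" "2 * q + 1 \<le> ?N" for q
    unfolding a_def by (rule scaled_level_odd[of "{1..n} - R" "2 * q + 1", unfolded N]) (use that in auto)
  then have "a (2 * p + 1) =
      (\<Sum>j=1..p. \<gamma> (p - j + 1) * real ((?N - 2 * j) choose (2 * p - 2 * j + 1)) * a (2 * j))"
    by (intro odd_terms_from_even_terms assms)
  then show ?thesis
    using assms(6,7) by (simp add: A)
qed

end
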